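(* Let $\beta>0$. The bilevel problem $$\max_{x\in X,\ \bar y}\ \sum_{s\in[S]}\rho_s\langle\theta_s(x)-C_s,y_s\rangle_W\quad\text{s.t. } \bar y_s\in\arg\min_{\bar y_s'\in\Delta_{W+1}}\Big\{\langle\theta_s(x)-R_s,y_s'\rangle_W+\tfrac1\beta\langle\bar y_s'-1,\bar y_s'\rangle_{W+1}\Big\}\ \ \forall s\in[S]$$ is equivalent to the following quadratic program with complementarity constraints, whose objective is concave: $$\max_{x\in X,\ \mu\in\mathbb{R}^S,\ \bar y}\ \sum_{s\in[S]}\Big(\rho_s\mu_s+\rho_s\langle R_s-C_s,y_s\rangle_W-2\beta^{-1}\rho_s\|\bar y_s\|_{W+1}^2\Big)$$ subject to $$0\le y_{sw}\perp\theta_{sw}(x)-R_{sw}+2\beta^{-1}y_{sw}-\mu_s\ge0\quad\forall s\in[S],w\in[W],$$ $$0\le y_{s0}\perp 2\beta^{-1}y_{s0}-\mu_s\ge0\quad\forall s\in[S],\qquad \bar y_s\in\Delta_{W+1}\quad\forall s\in[S].$$ Here equivalent means: $(x,\bar y)$ is feasible for the bilevel problem if and only if there is $\mu\in\mathbb{R}^S$ such that $(x,\mu,\bar y)$ is feasible for the second problem, and in that case the two objective values coincide.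
   Context: Setting: $S,W,H\ge1$ are integers, $X\subset\mathbb{R}^{W\times H}$ is a non-empty polytope. For $s\in[S]$, $w\in[W]$: $E_{sw}\in\mathbb{R}_{\ge0}^H$, $R_{sw},C_{sw}\in\mathbb{R}$, and weights $\rho_s\ge0$. $\theta_{sw}(x)=\langle E_{sw},x_w\rangle$, and $\theta_s(x),R_s,C_s\in\mathbb{R}^W$ are the corresponding vectors. $\bar y_s=(y_{s0},y_s)\in\mathbb{R}\times\mathbb{R}^W$. $\Delta_{W+1}$ is the standard simplex in $\mathbb{R}^{W+1}$; $\langle\cdot,\cdot\rangle_N$ and $\|\cdot\|_N$ are the canonical scalar product and Euclidean norm on $\mathbb{R}^N$; $\bar y_s'-1$ subtracts $1$ from each coordinate. The notation $0\le a\perp b\ge0$ means $a\ge0$, $b\ge0$, $ab=0$. *)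

theory Defs
  imports "HOL-Analysis.Analysis"
begin

text \<open>
  The index sets \<open>[S]\<close>, \<open>[W]\<close>, \<open>[H]\<close> are the finite (hence nonempty) types \<open>'s\<close>, \<open>'w\<close>, \<open>'h\<close>.
  A point of \<open>\<real>\<^bsup>W\<times>H\<^esup>\<close> is \<open>x :: real^'h^'w\<close>, so that \<open>x $ w\<close> is the row \<open>x\<^sub>w \<in> \<real>\<^sup>H\<close>.
  The vector \<open>(y\<^sub>0, y)\<close> of \<open>\<real>\<^bsup>W+1\<^esup>\<close> is an element of \<open>real \<times> (real^'w)\<close>; the inner product and
  the norm of this product type are the canonical Euclidean ones.
\<close>

definition theta :: "real^'h^'w^'s \<Rightarrow> real^'h^'w \<Rightarrow> 's \<Rightarrow> real^'w"
  where "theta E x s = (\<chi> w. (E $ s $ w) \<bullet> (x $ w))"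

definition std_simplex :: "(real \<times> (real^'w)) set"
  where "std_simplex =
    {(y0, y). 0 \<le> y0 \<and> (\<forall>w. 0 \<le> y $ w) \<and> y0 + (\<Sum>w\<in>UNIV. y $ w) = 1}"

definition complementary :: "real \<Rightarrow> real \<Rightarrow> bool"
  where "complementary a b \<longleftrightarrow> 0 \<le> a \<and> 0 \<le> b \<and> a * b = 0"

definition lower_obj ::
    "real \<Rightarrow> real^'h^'w^'s \<Rightarrow> real^'w^'s \<Rightarrow> real^'h^'w \<Rightarrow> 's \<Rightarrow> real \<times> (real^'w) \<Rightarrow> real"
  where "lower_obj \<beta> E R x s yb =
    (theta E x s - R $ s) \<bullet> snd yb + 1 / \<beta> * ((yb - (1, vec 1)) \<bullet> yb)"

definition bilevel_feasible ::
    "(real^'h^'w) set \<Rightarrow> real \<Rightarrow> real^'h^'w^'s \<Rightarrow> real^'w^'s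
      \<Rightarrow> ((real^'h^'w) \<times> ((real \<times> (real^'w))^'s)) set"
  where "bilevel_feasible X \<beta> E R =
    {(x, yb). x \<in> X \<and>
      (\<forall>s. is_arg_min (lower_obj \<beta> E R x s) (\<lambda>yb'. yb' \<in> std_simplex) (yb $ s))}"

definition bilevel_obj ::
    "real^'s \<Rightarrow> real^'h^'w^'s \<Rightarrow> real^'w^'s \<Rightarrow> (real^'h^'w) \<times> ((real \<times> (real^'w))^'s) \<Rightarrow> real"
  where "bilevel_obj \<rho> E C =
    (\<lambda>(x, yb). \<Sum>s\<in>UNIV. \<rho> $ s * ((theta E x s - C $ s) \<bullet> snd (yb $ s)))"

definition qpcc_feasible ::
    "(real^'h^'w) set \<Rightarrow> real \<Rightarrow> real^'h^'w^'s \<Rightarrow> real^'w^'s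
      \<Rightarrow> ((real^'h^'w) \<times> (real^'s) \<times> ((real \<times> (real^'w))^'s)) set"
  where "qpcc_feasible X \<beta> E R =
    {(x, \<mu>, yb). x \<in> X \<and>
      (\<forall>s w. complementary (snd (yb $ s) $ w)
        (theta E x s $ w - R $ s $ w + 2 / \<beta> * snd (yb $ s) $ w - \<mu> $ s)) \<and>
      (\<forall>s. complementary (fst (yb $ s)) (2 / \<beta> * fst (yb $ s) - \<mu> $ s)) \<and>
      (\<forall>s. yb $ s \<in> std_simplex)}"

definition qpcc_obj ::
    "real \<Rightarrow> real^'s \<Rightarrow> real^'w^'s \<Rightarrow> real^'w^'s
      \<Rightarrow> (real^'h^'w) \<times> (real^'s) \<times> ((real \<times> (real^'w))^'s) \<Rightarrow> real"
  where "qpcc_obj \<beta> \<rho> R C =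
    (\<lambda>(x, \<mu>, yb). \<Sum>s\<in>UNIV.
      \<rho> $ s * \<mu> $ s + \<rho> $ s * ((R $ s - C $ s) \<bullet> snd (yb $ s))
        - 2 / \<beta> * \<rho> $ s * (norm (yb $ s))\<^sup>2)"

end

(* On the simplex the lower-level objective is, up to a constant, c . y + (1/beta) |y|^2, which is
   convex, so minimality is the first-order variational inequality g . (z - y) >= 0 for all z in the
   simplex, where g = c + (2/beta) y.  Testing it at the vertices turns it into complementarity
   between y and g - mu, with the single multiplier mu = g . y.  This last identity also lets one
   trade the bilinear term theta_s(x) . y_s of the upper objective for
   mu_s + R_s . y_s - (2/beta) |y_s|^2. *)
theory Submission
  imports Defs
begin

text \<open>Forward: a short move from \<open>y\<close> towards \<open>z\<close> stays in
  \<open>K\<close> and cannot decrease the value; divide by the step length and let it tend to 0.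
  Backward: the expansion around \<open>y\<close> is exact, and its remainder is \<open>k\<close>
  times a squared distance.\<close>

lemma quadratic_minimal_iff_variational_ineq:
  fixes c y :: "'a::real_inner"
  assumes "convex K" "y \<in> K" "0 \<le> k"
  shows "(\<forall>z\<in>K. c \<bullet> y + k * (y \<bullet> y) \<le> c \<bullet> z + k * (z \<bullet> z))
    \<longleftrightarrow> (\<forall>z\<in>K. 0 \<le> (c + (2 * k) *\<^sub>R y) \<bullet> (z - y))" (is "?min \<longleftrightarrow> ?vi")
proof
  assume min: ?min
  show ?vi
  proof
    fix z assume "z \<in> K"
    define d where "d = z - y"
    define g where "g = (c + (2 * k) *\<^sub>R y) \<bullet> d"
    have first_order: "0 \<le> g + t * (k * (d \<bullet> d))" if t: "0 < t" "t \<le> 1" for t :: real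
    proof -
      have "(1 - t) *\<^sub>R y + t *\<^sub>R z \<in> K"
        using assms(1,2) \<open>z \<in> K\<close> t by (intro convexD_alt) auto
      moreover have "(1 - t) *\<^sub>R y + t *\<^sub>R z = y + t *\<^sub>R d"
        by (simp add: d_def algebra_simps)
      ultimately have "c \<bullet> y + k * (y \<bullet> y)
          \<le> c \<bullet> (y + t *\<^sub>R d) + k * ((y + t *\<^sub>R d) \<bullet> (y + t *\<^sub>R d))"
        using min by metis
      \<comment> \<open>The increment carries a factor \<open>t\<close>, which is cancelled below
        because \<open>0 < t\<close>.\<close>
      also have "\<dots> = c \<bullet> y + k * (y \<bullet> y) + t * (g + t * (k * (d \<bullet> d)))"
        by (simp add: g_def inner_add inner_commute algebra_simps)
      finally have "0 \<le> t * (g + t * (k * (d \<bullet> d)))" by simp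
      then show ?thesis using t by (simp add: zero_le_mult_iff)
    qed
    \<comment> \<open>The bound is known only for \<open>t\<close> in (0, 1], hence the one-sided
      limit.\<close>
    have "((\<lambda>t. g + t * (k * (d \<bullet> d))) \<longlongrightarrow> g + 0 * (k * (d \<bullet> d))) (at_right 0)"
      by (intro tendsto_intros)
    moreover have "\<forall>\<^sub>F t in at_right 0. 0 \<le> g + t * (k * (d \<bullet> d))"
      using first_order by (auto simp: eventually_at_right_field intro!: exI[of _ 1])
    ultimately have "0 \<le> g + 0 * (k * (d \<bullet> d))"
      by (intro tendsto_lowerbound[where F = "at_right 0"]) auto
    then show "0 \<le> (c + (2 * k) *\<^sub>R y) \<bullet> (z - y)" by (simp add: g_def d_def)
  qed
next
  assume vi: ?vi
  show ?min
  proof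
    fix z assume "z \<in> K"
    have "c \<bullet> z + k * (z \<bullet> z)
        = c \<bullet> y + k * (y \<bullet> y) + (c + (2 * k) *\<^sub>R y) \<bullet> (z - y) + k * ((z - y) \<bullet> (z - y))"
      by (simp add: inner_add inner_diff inner_commute algebra_simps)
    moreover have "0 \<le> k * ((z - y) \<bullet> (z - y))" using assms(3) by simp
    ultimately show "c \<bullet> y + k * (y \<bullet> y) \<le> c \<bullet> z + k * (z \<bullet> z)"
      using vi \<open>z \<in> K\<close> by fastforce
  qed
qed

lemma inner_prod_vec:
  fixes p q :: "real \<times> (real^'w)"
  shows "p \<bullet> q = fst p * fst q + (\<Sum>w\<in>UNIV. snd p $ w * snd q $ w)"
  by (simp add: inner_prod_def inner_vec_def)

lemma convex_std_simplex: "convex (std_simplex :: (real \<times> (real^'w)) set)"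
proof (rule convexI)
  fix p q :: "real \<times> (real^'w)" and u v :: real
  assume p: "p \<in> std_simplex" and q: "q \<in> std_simplex" and uv: "0 \<le> u" "0 \<le> v" "u + v = 1"
  have "fst (u *\<^sub>R p + v *\<^sub>R q) + (\<Sum>w\<in>UNIV. snd (u *\<^sub>R p + v *\<^sub>R q) $ w)
      = u * (fst p + (\<Sum>w\<in>UNIV. snd p $ w)) + v * (fst q + (\<Sum>w\<in>UNIV. snd q $ w))"
    by (simp add: sum.distrib sum_distrib_left algebra_simps)
  also have "\<dots> = 1" using p q uv by (auto simp: std_simplex_def)
  finally show "u *\<^sub>R p + v *\<^sub>R q \<in> std_simplex"
    using p q uv by (auto simp: std_simplex_def)
qed

text \<open>Complementarity makes each product of coordinates of \<open>g\<close> and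
  \<open>p\<close> equal to \<open>\<mu>\<close> times the coordinate of \<open>p\<close>, and the
  latter coordinates add up to 1.\<close>

lemma inner_simplex_eq_multiplier:
  assumes p: "p \<in> std_simplex"
    and "complementary (fst p) (fst g - \<mu>)"
    and "\<And>w. complementary (snd p $ w) (snd g $ w - \<mu>)"
  shows "g \<bullet> p = \<mu>"
proof -
  have "fst g * fst p = \<mu> * fst p" "snd g $ w * snd p $ w = \<mu> * snd p $ w" for w
    using assms(2) assms(3)[of w] by (auto simp: complementary_def)
  then have "g \<bullet> p = \<mu> * (fst p + (\<Sum>w\<in>UNIV. snd p $ w))"
    by (simp only: inner_prod_vec sum_distrib_left distrib_left)
  also have "\<dots> = \<mu>" using p by (auto simp: std_simplex_def)
  finally show ?thesis .
qed

text \<open>A linear functional is minimal at \<open>p\<close> over the simplex exactly when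
  \<open>p\<close> puts its mass on the smallest coordinates of \<open>g\<close>. The number
  \<open>\<mu>\<close> is that smallest value, the multiplier of the sum-to-one constraint.\<close>

lemma variational_ineq_simplex_iff_complementary:
  fixes g p :: "real \<times> (real^'w)"
  assumes p: "p \<in> std_simplex"
  shows "(\<forall>z\<in>std_simplex. 0 \<le> g \<bullet> (z - p)) \<longleftrightarrow>
    (\<exists>\<mu>. (\<forall>w. complementary (snd p $ w) (snd g $ w - \<mu>)) \<and> complementary (fst p) (fst g - \<mu>))"
    (is "?vi \<longleftrightarrow> ?comp")
proof
  assume vi: ?vi
  \<comment> \<open>The only possible choice, by \<open>inner_simplex_eq_multiplier\<close>.\<close>
  define \<mu> where "\<mu> = g \<bullet> p"
  have p_nonneg: "0 \<le> fst p" "0 \<le> snd p $ w" for w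
    using p by (auto simp: std_simplex_def)
  have p_sum: "fst p + (\<Sum>w\<in>UNIV. snd p $ w) = 1"
    using p by (auto simp: std_simplex_def)
  \<comment> \<open>At a vertex the inequality bounds one coordinate of \<open>g\<close> below by
    \<open>\<mu>\<close>; the remaining vertices are \<open>(0, axis w 1)\<close>.\<close>
  have "((1, 0) :: real \<times> (real^'w)) \<in> std_simplex" by (simp add: std_simplex_def)
  then have "0 \<le> g \<bullet> ((1, 0) - p)" using vi by blast
  then have g0: "\<mu> \<le> fst g"
    by (simp add: \<mu>_def inner_diff_right inner_prod_def right_diff_distrib)
  have gw: "\<mu> \<le> snd g $ w" for w
  proof -
    have "((0, axis w 1) :: real \<times> (real^'w)) \<in> std_simplex"
      by (simp add: std_simplex_def axis_def)
    then have "0 \<le> g \<bullet> ((0, axis w 1) - p)" using vi by blast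
    then show ?thesis by (simp add: \<mu>_def inner_diff_right inner_prod_def inner_axis)
  qed
  \<comment> \<open>The complementarity products sum to 0 and are all nonnegative, so each of them
    vanishes.\<close>
  have "fst p * (fst g - \<mu>) + (\<Sum>w\<in>UNIV. snd p $ w * (snd g $ w - \<mu>))
      = g \<bullet> p - \<mu> * (fst p + (\<Sum>w\<in>UNIV. snd p $ w))"
    by (simp add: inner_prod_vec sum_distrib_left sum_subtractf algebra_simps)
  also have "\<dots> = 0" by (simp add: p_sum \<mu>_def)
  finally have "fst p * (fst g - \<mu>) = 0 \<and> (\<Sum>w\<in>UNIV. snd p $ w * (snd g $ w - \<mu>)) = 0"
    using p_nonneg g0 gw by (subst (asm) add_nonneg_eq_0_iff) (auto intro!: sum_nonneg)
  then have "complementary (fst p) (fst g - \<mu>)"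
    and "\<forall>w. complementary (snd p $ w) (snd g $ w - \<mu>)"
    using p_nonneg g0 gw by (auto simp: complementary_def sum_nonneg_eq_0_iff)
  then show ?comp by blast
next
  assume ?comp
  then obtain \<mu> where comp: "\<And>w. complementary (snd p $ w) (snd g $ w - \<mu>)"
    "complementary (fst p) (fst g - \<mu>)" by blast
  have g_ge: "\<mu> \<le> fst g" "\<mu> \<le> snd g $ w" for w
    using comp(1)[of w] comp(2) by (auto simp: complementary_def)
  show ?vi
  proof
    fix z :: "real \<times> (real^'w)" assume z: "z \<in> std_simplex"
    \<comment> \<open>Since \<open>g \<bullet> z\<close> is a weighted average of coordinates that
      are at least \<open>\<mu>\<close>, it is at least \<open>\<mu>\<close>, which equals
      \<open>g \<bullet> p\<close>.\<close>
    then have "\<mu> = \<mu> * (fst z + (\<Sum>w\<in>UNIV. snd z $ w))" by (auto simp: std_simplex_def)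
    also have "\<dots> = \<mu> * fst z + (\<Sum>w\<in>UNIV. \<mu> * snd z $ w)"
      by (simp add: sum_distrib_left algebra_simps)
    also have "\<dots> \<le> g \<bullet> z"
      unfolding inner_prod_vec using z g_ge
      by (intro add_mono sum_mono mult_right_mono) (auto simp: std_simplex_def)
    finally show "0 \<le> g \<bullet> (z - p)"
      using inner_simplex_eq_multiplier[OF p comp(2,1)] by (simp add: inner_diff_right)
  qed
qed

text \<open>The all-ones vector has inner product 1 with every point of the simplex, so the shift by
  1 costs only a constant. The linear cost is padded with 0 in the slot of \<open>fst p\<close>,
  giving the form of \<open>quadratic_minimal_iff_variational_ineq\<close>.\<close>

lemma lower_obj_on_simplex:
  assumes "p \<in> std_simplex"
  shows "lower_obj \<beta> E R x s p
    = (0, theta E x s - R $ s) \<bullet> p + 1 / \<beta> * (p \<bullet> p) - 1 / \<beta>"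
proof -
  have "(1, vec 1) \<bullet> p = 1"
    using assms by (auto simp: inner_prod_vec std_simplex_def)
  then show ?thesis
    by (simp add: lower_obj_def inner_diff_left inner_prod_def[of "(0, _)"] right_diff_distrib)
qed

lemma is_arg_min_lower_obj_iff_complementary:
  fixes p :: "real \<times> (real^'w)"
  assumes "0 < \<beta>"
  shows "is_arg_min (lower_obj \<beta> E R x s) (\<lambda>q. q \<in> std_simplex) p \<longleftrightarrow>
    p \<in> std_simplex \<and>
    (\<exists>\<mu>. (\<forall>w. complementary (snd p $ w)
              (theta E x s $ w - R $ s $ w + 2 / \<beta> * snd p $ w - \<mu>)) \<and>
         complementary (fst p) (2 / \<beta> * fst p - \<mu>))"
proof (cases "p \<in> std_simplex")
  case True
  let ?c = "(0, theta E x s - R $ s)"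
  have "is_arg_min (lower_obj \<beta> E R x s) (\<lambda>q. q \<in> std_simplex) p \<longleftrightarrow>
      (\<forall>z\<in>std_simplex. ?c \<bullet> p + 1 / \<beta> * (p \<bullet> p) \<le> ?c \<bullet> z + 1 / \<beta> * (z \<bullet> z))"
    using True by (auto simp: is_arg_min_linorder lower_obj_on_simplex)
  also have "\<dots> \<longleftrightarrow> (\<forall>z\<in>std_simplex. 0 \<le> (?c + (2 * (1 / \<beta>)) *\<^sub>R p) \<bullet> (z - p))"
    using assms True by (intro quadratic_minimal_iff_variational_ineq convex_std_simplex) auto
  \<comment> \<open>The two expressions before \<open>- \<mu>\<close> are the coordinates of the
    gradient \<open>?c + (2 * (1 / \<beta>)) *\<^sub>R p\<close>.\<close>
  also have "\<dots> \<longleftrightarrow> (\<exists>\<mu>. (\<forall>w. complementary (snd p $ w)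
              (theta E x s $ w - R $ s $ w + 2 / \<beta> * snd p $ w - \<mu>)) \<and>
         complementary (fst p) (2 / \<beta> * fst p - \<mu>))"
    by (simp add: variational_ineq_simplex_iff_complementary[OF True])
  finally show ?thesis using True by blast
qed (simp add: is_arg_min_linorder)

lemma bilevel_feasible_iff_qpcc_feasible:
  assumes "0 < \<beta>"
  shows "(x, yb) \<in> bilevel_feasible X \<beta> E R \<longleftrightarrow> (\<exists>\<mu>. (x, \<mu>, yb) \<in> qpcc_feasible X \<beta> E R)"
proof -
  let ?comp = "\<lambda>s \<mu>. (\<forall>w. complementary (snd (yb $ s) $ w)
        (theta E x s $ w - R $ s $ w + 2 / \<beta> * snd (yb $ s) $ w - \<mu>)) \<and>
      complementary (fst (yb $ s)) (2 / \<beta> * fst (yb $ s) - \<mu>)"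
  \<comment> \<open>The lower-level problems decouple over \<open>s\<close>, so the scalar
    multipliers can be chosen separately and collected into one vector.\<close>
  have "(\<forall>s. \<exists>\<mu>. ?comp s \<mu>) \<longleftrightarrow> (\<exists>\<mu>. \<forall>s. ?comp s (\<mu> $ s))"
    unfolding choice_iff by (metis vec_lambda_beta)
  then show ?thesis
    unfolding bilevel_feasible_def qpcc_feasible_def
      is_arg_min_lower_obj_iff_complementary[OF assms] by blast
qed

lemma qpcc_feasible_obj_eq:
  assumes "(x, \<mu>, yb) \<in> qpcc_feasible X \<beta> E R"
  shows "bilevel_obj \<rho> E C (x, yb) = qpcc_obj \<beta> \<rho> R C (x, \<mu>, yb)"
proof -
  have "\<rho> $ s * ((theta E x s - C $ s) \<bullet> snd (yb $ s)) =
      \<rho> $ s * \<mu> $ s + \<rho> $ s * ((R $ s - C $ s) \<bullet> snd (yb $ s))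
        - 2 / \<beta> * \<rho> $ s * (norm (yb $ s))\<^sup>2" for s
  proof -
    let ?p = "yb $ s"
    have "((0, theta E x s - R $ s) + (2 / \<beta>) *\<^sub>R ?p) \<bullet> ?p = \<mu> $ s"
      using assms by (intro inner_simplex_eq_multiplier) (auto simp: qpcc_feasible_def)
    then have "(theta E x s - R $ s) \<bullet> snd ?p + 2 / \<beta> * (norm ?p)\<^sup>2 = \<mu> $ s"
      by (simp add: inner_add_left inner_prod_def[of "(0, _)"] power2_norm_eq_inner)
    \<comment> \<open>Adding \<open>(R $ s - C $ s) \<bullet> snd ?p\<close> to both sides replaces
      \<open>R\<close> by \<open>C\<close> on the left.\<close>
    then have *: "(theta E x s - C $ s) \<bullet> snd ?p
        = \<mu> $ s + (R $ s - C $ s) \<bullet> snd ?p - 2 / \<beta> * (norm ?p)\<^sup>2"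
      by (simp add: inner_diff_left)
    show ?thesis unfolding * by (simp add: algebra_simps)
  qed
  then show ?thesis by (simp add: bilevel_obj_def qpcc_obj_def)
qed

text \<open>The gap between the two sides is exactly
  \<open>u * v * (norm (a - b))\<^sup>2\<close>.\<close>

lemma norm_power2_convex_combination_le:
  fixes a b :: "'a::real_inner"
  assumes "0 \<le> u" "0 \<le> v" "u + v = 1"
  shows "(norm (u *\<^sub>R a + v *\<^sub>R b))\<^sup>2 \<le> u * (norm a)\<^sup>2 + v * (norm b)\<^sup>2"
proof -
  have u: "u = 1 - v" using assms by simp
  have "u * (norm a)\<^sup>2 + v * (norm b)\<^sup>2 - (norm (u *\<^sub>R a + v *\<^sub>R b))\<^sup>2
      = u * v * (norm (a - b))\<^sup>2"
    unfolding power2_norm_eq_inner u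
    by (simp add: inner_add inner_diff inner_commute algebra_simps)
  moreover have "0 \<le> u * v * (norm (a - b))\<^sup>2" using assms by simp
  ultimately show ?thesis by linarith
qed

text \<open>The only nonlinear terms are squared norms with coefficients of constant sign, the
  product of \<open>x\<close> and \<open>y\<close> having been traded for \<open>\<mu>\<close>. The
  domain is the whole space because complementarity constraints need not cut out a convex
  set.\<close>

lemma concave_on_qpcc_obj:
  fixes \<rho> :: "real^'s" and R C :: "real^'w^'s"
  assumes "\<And>s. 0 \<le> \<rho> $ s" "0 < \<beta>"
  shows "concave_on UNIV
    (qpcc_obj \<beta> \<rho> R C :: (real^'h^'w) \<times> (real^'s) \<times> ((real \<times> (real^'w))^'s) \<Rightarrow> real)"
  unfolding concave_on_iff
proof (intro conjI ballI allI impI convex_UNIV)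
  fix P Q :: "(real^'h^'w) \<times> (real^'s) \<times> ((real \<times> (real^'w))^'s)" and u v :: real
  assume uv: "0 \<le> u" "0 \<le> v" "u + v = 1"
  obtain x \<mu> y x' \<mu>' y' where PQ: "P = (x, \<mu>, y)" "Q = (x', \<mu>', y')"
    by (metis prod_cases3)
  let ?t = "\<lambda>\<mu> y s. \<rho> $ s * \<mu> $ s + \<rho> $ s * ((R $ s - C $ s) \<bullet> snd (y $ s))
        - 2 / \<beta> * \<rho> $ s * (norm (y $ s))\<^sup>2"
  \<comment> \<open>Concavity is checked for each summand \<open>?t\<close> and then added up over
    \<open>s\<close>.\<close>
  have "u * ?t \<mu> y s + v * ?t \<mu>' y' s \<le> ?t (u *\<^sub>R \<mu> + v *\<^sub>R \<mu>') (u *\<^sub>R y + v *\<^sub>R y') s" for s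
  proof -
    have "2 / \<beta> * \<rho> $ s * (norm (u *\<^sub>R (y $ s) + v *\<^sub>R (y' $ s)))\<^sup>2
        \<le> 2 / \<beta> * \<rho> $ s * (u * (norm (y $ s))\<^sup>2 + v * (norm (y' $ s))\<^sup>2)"
      using assms uv by (intro mult_left_mono norm_power2_convex_combination_le) auto
    then show ?thesis by (simp add: inner_add_right algebra_simps)
  qed
  then show "u * qpcc_obj \<beta> \<rho> R C P + v * qpcc_obj \<beta> \<rho> R C Q
      \<le> qpcc_obj \<beta> \<rho> R C (u *\<^sub>R P + v *\<^sub>R Q)"
    unfolding PQ qpcc_obj_def
    by (simp add: sum_distrib_left flip: sum.distrib) (intro sum_mono, simp)
qed

theorem theorem3p16:
  fixes X :: "(real^'h^'w) set"
    and E :: "real^'h^'w^'s"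
    and R C :: "real^'w^'s"
    and \<rho> :: "real^'s"
    and \<beta> :: real
  assumes "polytope X" and "X \<noteq> {}"
    and "\<And>s w h. 0 \<le> E $ s $ w $ h"
    and "\<And>s. 0 \<le> \<rho> $ s"
    and "0 < \<beta>"
  shows "(\<forall>x yb. (x, yb) \<in> bilevel_feasible X \<beta> E R
            \<longleftrightarrow> (\<exists>\<mu>. (x, \<mu>, yb) \<in> qpcc_feasible X \<beta> E R))
    \<and> (\<forall>x \<mu> yb. (x, \<mu>, yb) \<in> qpcc_feasible X \<beta> E R
            \<longrightarrow> bilevel_obj \<rho> E C (x, yb) = qpcc_obj \<beta> \<rho> R C (x, \<mu>, yb))
    \<and> concave_on UNIV
        (qpcc_obj \<beta> \<rho> R C :: (real^'h^'w) \<times> (real^'s) \<times> ((real \<times> (real^'w))^'s) \<Rightarrow> real)"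
  using bilevel_feasible_iff_qpcc_feasible[OF assms(5)] qpcc_feasible_obj_eq
    concave_on_qpcc_obj[OF assms(4,5)]
  by blast

end
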